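(* Let $R$ be a supertropical domain, let $A\in M_n(R)$ be quasi-invertible (i.e. $|A|$ is invertible in $R$), and let $B\in M_n(R)$. If $AB=I_A$, then $A^{\overline{\nabla}}\models_{gs}B$.
   Context: A semiring with ghosts is a triple $(R,\mathcal G_0,\nu)$ where $R$ is a semiring with zero $0_R$ and unit $1_R$, $\mathcal G_0=\mathcal G\cup\{0_R\}$ is a semiring ideal (the ghost ideal, whose elements are called ghost), and $\nu:R\to\mathcal G_0$, $\nu(a)=a+a$ (written $a^\nu$), is an idempotent semiring homomorphism. It is a supertropical semiring if $a+b=a^\nu$ whenever $a^\nu=b^\nu$, and $a+b\in\{a,b\}$ whenever $a^\nu\ne b^\nu$ (equivalently, $\mathcal G_0$ is totally ordered via $a^\nu\le b^\nu$ iff $a^\nu+b^\nu=b^\nu$). A supertropical domain is a commutative supertropical semiring such that $\mathcal T=R\setminus\mathcal G_0$ (the tangible elements) is a monoid under multiplication and $\nu|_{\mathcal T}:\mathcal T\to\mathcal G$ is onto. Write $b\models_{gs}a$ ("ghost surpasses") if $b=a+c$ for some $c\in\mathcal G_0$; for matrices the relation is taken entrywise. For $A=(a_{i,j})\in M_n(R)$, $|A|=\sum_{\sigma\in S_n}a_{1,\sigma(1)}\cdots a_{n,\sigma(n)}$ (the permanent), $A_{i,j}$ is obtained by deleting row $i$ and column $j$, and $\operatorname{adj}(A)$ has $(i,j)$ entry $|A_{j,i}|$ (the empty determinant is $1_R$). If $|A|$ is invertible: $A^{\nabla}=|A|^{-1}\operatorname{adj}(A)$, $I_A=AA^{\nabla}$,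 and $A^{\overline{\nabla}}=A^{\nabla}I_A=A^{\nabla}AA^{\nabla}$. *)

theory Defs
  imports "Jordan_Normal_Form.Determinant"
begin

definition nu :: "'a::semiring_1 \<Rightarrow> 'a" where
  "nu a = a + a"

text \<open>The carrier of the semiring is the whole type, so a semiring with ghosts is determined by
  its ghost ideal \<open>G0\<close>.  Here \<open>1 \<noteq> 0\<close> is built into the type class; this is no restriction for
  supertropical domains, whose tangible elements contain \<open>1\<close> but not \<open>0\<close>.\<close>

locale semiring_with_ghosts =
  fixes G0 :: "'a::semiring_1 set"
  assumes zero_ghost: "0 \<in> G0"
    and add_ghost: "g \<in> G0 \<Longrightarrow> h \<in> G0 \<Longrightarrow> g + h \<in> G0"
    and mult_ghost_left: "g \<in> G0 \<Longrightarrow> a * g \<in> G0"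
    and mult_ghost_right: "g \<in> G0 \<Longrightarrow> g * a \<in> G0"
    and nu_ghost: "nu a \<in> G0"
    and nu_idem: "nu (nu a) = nu (a :: 'a)"
    and nu_zero: "nu (0 :: 'a) = 0"
    and nu_add: "nu (a + b) = nu a + nu (b :: 'a)"
    and nu_mult: "nu (a * b) = nu a * nu (b :: 'a)"
    (* nu maps 1 to the unit of the semiring G0, which need not be the 1 of the type *)
    and nu_one: "g \<in> G0 \<Longrightarrow> nu 1 * g = g \<and> g * nu 1 = g"

locale supertropical_semiring = semiring_with_ghosts G0
  for G0 :: "'a::semiring_1 set" +
  assumes add_nu_eq: "nu a = nu b \<Longrightarrow> a + b = nu (a :: 'a)"
    and add_nu_neq: "nu a \<noteq> nu b \<Longrightarrow> a + b \<in> {a, b :: 'a}"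

text \<open>The tangible elements are \<open>- G0\<close>, and \<open>\<G> = G0 - {0}\<close>: if \<open>nu t = 0 = nu 0\<close> then
  \<open>t = t + 0 = nu t = 0\<close> is not tangible, so \<open>0\<close> cannot lie in \<open>\<G>\<close> when \<open>nu\<close> maps the tangible
  elements onto \<open>\<G>\<close>.\<close>

locale supertropical_domain = supertropical_semiring G0
  for G0 :: "'a::comm_semiring_1 set" +
  assumes one_tangible: "1 \<in> - G0"
    and mult_tangible: "a \<in> - G0 \<Longrightarrow> b \<in> - G0 \<Longrightarrow> a * b \<in> - G0"
    and nu_tangible_onto: "nu ` (- G0) = G0 - {0}"

definition ghost_surpasses :: "'a::semiring_1 set \<Rightarrow> 'a \<Rightarrow> 'a \<Rightarrow> bool" where
  "ghost_surpasses G0 b a \<longleftrightarrow> (\<exists>c\<in>G0. b = a + c)"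

definition mat_ghost_surpasses :: "'a::semiring_1 set \<Rightarrow> 'a mat \<Rightarrow> 'a mat \<Rightarrow> bool" where
  "mat_ghost_surpasses G0 B A \<longleftrightarrow>
     dim_row B = dim_row A \<and> dim_col B = dim_col A \<and>
     (\<forall>i<dim_row A. \<forall>j<dim_col A. ghost_surpasses G0 (B $$ (i, j)) (A $$ (i, j)))"

definition permanent :: "'a::comm_semiring_1 mat \<Rightarrow> 'a" where
  "permanent A = (\<Sum>p | p permutes {0..<dim_row A}. \<Prod>i = 0..<dim_row A. A $$ (i, p i))"

definition perm_adj :: "'a::comm_semiring_1 mat \<Rightarrow> 'a mat" where
  "perm_adj A = mat (dim_row A) (dim_col A) (\<lambda>(i, j). permanent (mat_delete A j i))"

definition quasi_invertible :: "'a::comm_semiring_1 mat \<Rightarrow> bool" where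
  "quasi_invertible A \<longleftrightarrow> permanent A dvd 1"

definition unit_inverse :: "'a::comm_semiring_1 \<Rightarrow> 'a" where
  "unit_inverse a = (THE b. a * b = 1)"

definition nabla :: "'a::comm_semiring_1 mat \<Rightarrow> 'a mat" where
  "nabla A = unit_inverse (permanent A) \<cdot>\<^sub>m perm_adj A"

definition quasi_identity :: "'a::comm_semiring_1 mat \<Rightarrow> 'a mat" where
  "quasi_identity A = A * nabla A"

definition nabla_bar :: "'a::comm_semiring_1 mat \<Rightarrow> 'a mat" where
  "nabla_bar A = nabla A * quasi_identity A"

end

theory Submission
  imports Defs
begin

text \<open>The product in the other order, \<open>nabla A * A\<close>, is the identity matrix up to ghosts.  By
  Laplace expansion along a column (\<open>permanent_expand_column\<close>), the entry \<open>(i, j)\<close> of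
  \<open>perm_adj A * A\<close> is the permanent of \<open>A\<close> with column \<open>i\<close> overwritten by column \<open>j\<close>
  (\<open>perm_adj_mult_entry\<close>).  For \<open>i = j\<close> this is \<open>permanent A\<close>, which the scalar in \<open>nabla A\<close>
  cancels; for \<open>i \<noteq> j\<close> two columns agree, so each summand of the permanent occurs twice and
  the whole is of the form \<open>x + x\<close>, a ghost (\<open>permanent_equal_columns\<close>).

  Associativity and the hypothesis \<open>A * B = A * nabla A\<close> now give
  \<open>nabla_bar A = nabla A * (A * nabla A) = nabla A * (A * B) = (nabla A * A) * B\<close>, and
  multiplying \<open>B\<close> by a matrix that is the identity up to ghosts adds only ghosts to each entry
  of \<open>B\<close>.\<close>

lemma permanent_carrier:
  assumes "A \<in> carrier_mat n n"
  shows "permanent A = (\<Sum>p | p permutes {0..<n}. \<Prod>i = 0..<n. A $$ (i, p i))"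
  using assms unfolding permanent_def by auto

text \<open>After the factor in row \<open>i\<close> is split off, \<open>insert_index i\<close> renumbers the remaining rows as
  those of the minor, and \<open>permutation_insert i j q\<close> acts on them as \<open>q\<close>.\<close>

lemma prod_permutation_insert:
  fixes A :: "'a::comm_semiring_1 mat"
  assumes A: "A \<in> carrier_mat (Suc l) (Suc l)"
    and i: "i < Suc l" and j: "j < Suc l" and q: "q permutes {0..<l}"
  shows "(\<Prod>k = 0..<Suc l. A $$ (k, permutation_insert i j q k))
    = A $$ (i, j) * (\<Prod>k = 0..<l. mat_delete A i j $$ (k, q k))"
proof -
  let ?p = "permutation_insert i j q"
  have ins: "?p (insert_index i k) = insert_index j (q k)" for k
    unfolding permutation_insert_expand insert_index_def by auto
  have inj: "inj_on (insert_index i) {0..<l}"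
    by (metis delete_insert_index inj_onI)
  have "(\<Prod>k = 0..<Suc l. A $$ (k, ?p k))
      = A $$ (i, ?p i) * (\<Prod>k\<in>{0..<Suc l} - {i}. A $$ (k, ?p k))"
    using i by (intro prod.remove) auto
  also have "{0..<Suc l} - {i} = insert_index i ` {0..<l}"
    using insert_index_image[OF i] by simp
  also have "(\<Prod>k\<in>insert_index i ` {0..<l}. A $$ (k, ?p k))
      = (\<Prod>k = 0..<l. A $$ (insert_index i k, insert_index j (q k)))"
    using inj by (simp add: prod.reindex ins)
  also have "\<dots> = (\<Prod>k = 0..<l. mat_delete A i j $$ (k, q k))"
  proof (rule prod.cong[OF refl])
    fix k assume "k \<in> {0..<l}"
    with q have "k < l" "q k < l" using permutes_in_image[OF q, of k] by auto
    then show "A $$ (insert_index i k, insert_index j (q k)) = mat_delete A i j $$ (k, q k)"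
      by (rule mat_delete_index[OF A i j])
  qed
  finally show ?thesis by simp
qed

text \<open>Group the permutations by the row \<open>i\<close> that they send to the column \<open>j\<close>: each group
  contributes the entry \<open>(i, j)\<close> times the permanent of the corresponding minor.\<close>

lemma permanent_expand_column:
  fixes A :: "'a::comm_semiring_1 mat"
  assumes A: "A \<in> carrier_mat n n" and j: "j < n"
  shows "permanent A = (\<Sum>i<n. A $$ (i, j) * permanent (mat_delete A i j))"
proof -
  obtain l where n: "n = Suc l" using j by (cases n) auto
  note A = A[unfolded n] and j = j[unfolded n]
  let ?N = "{0..<Suc l}" and ?Q = "{q. q permutes {0..<l}}"
  let ?h = "\<lambda>p. \<Prod>k\<in>?N. A $$ (k, p k)"
  have jN: "j \<in> ?N" using j by simp
  have "permanent A = sum ?h (\<Union>i\<in>?N. {p. p permutes ?N \<and> p i = j})"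
    unfolding permanent_carrier[OF A] by (subst permutation_split_ran[OF jN]) (rule refl)
  also have "\<dots> = (\<Sum>i\<in>?N. sum ?h {p. p permutes ?N \<and> p i = j})"
    using permutation_disjoint_dom[OF _ _ jN] finite_permutations[of ?N]
    by (intro sum.UNION_disjoint) auto
  also have "\<dots> = (\<Sum>i\<in>?N. A $$ (i, j) * permanent (mat_delete A i j))"
  proof (rule sum.cong[OF refl])
    fix i assume "i \<in> ?N"
    then have i: "i < Suc l" by simp
    have D: "mat_delete A i j \<in> carrier_mat l l" using mat_delete_carrier[OF A] by simp
    have "sum ?h {p. p permutes ?N \<and> p i = j} = (\<Sum>q\<in>?Q. ?h (permutation_insert i j q))"
      unfolding permutation_fix[OF i j]
      by (simp only: sum.reindex[OF permutation_insert_inj_on[OF i j]] o_def)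
    also have "\<dots> = (\<Sum>q\<in>?Q. A $$ (i, j) * (\<Prod>k = 0..<l. mat_delete A i j $$ (k, q k)))"
      using prod_permutation_insert[OF A i j] by (intro sum.cong) auto
    also have "\<dots> = A $$ (i, j) * permanent (mat_delete A i j)"
      unfolding permanent_carrier[OF D] sum_distrib_left ..
    finally show "sum ?h {p. p permutes ?N \<and> p i = j}
        = A $$ (i, j) * permanent (mat_delete A i j)" .
  qed
  finally show ?thesis unfolding n atLeast0LessThan .
qed

text \<open>Composition with the transposition of the two equal columns pairs each even permutation
  with an odd one that has the same diagonal product, so the even half of the permanent equals
  the odd half.  Over a ring the same pairing shows that the determinant vanishes.\<close>

lemma permanent_equal_columns:
  fixes A :: "'a::comm_semiring_1 mat"
  assumes A: "A \<in> carrier_mat n n" and i: "i < n" and j: "j < n" and ij: "i \<noteq> j"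
    and eq: "\<And>k. k < n \<Longrightarrow> A $$ (k, i) = A $$ (k, j)"
  obtains x where "permanent A = nu x"
proof -
  let ?P = "{p. p permutes {0..<n}}" and ?t = "transpose i j"
  let ?E = "{p\<in>?P. evenperm p}" and ?O = "{p\<in>?P. \<not> evenperm p}"
  let ?h = "\<lambda>p. \<Prod>k = 0..<n. A $$ (k, p k)"
  have t: "?t permutes {0..<n}" using i j by (intro permutes_swap_id) auto
  have parity: "evenperm (?t \<circ> p) \<longleftrightarrow> \<not> evenperm p" if "p \<in> ?P" for p
  proof -
    have "permutation ?t" "permutation p"
      using that t by (auto intro: permutes_imp_permutation[of "{0..<n}"])
    then show ?thesis using ij by (simp add: evenperm_comp evenperm_swap)
  qed
  have perm: "?t \<circ> p \<in> ?P" if "p \<in> ?P" for p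
    using that t by (auto intro: permutes_compose)
  have invol: "?t \<circ> (?t \<circ> p) = p" for p :: "nat \<Rightarrow> nat"
    by (simp add: fun_eq_iff)
  have same: "?h (?t \<circ> p) = ?h p" for p
    using eq by (intro prod.cong) (auto simp: transpose_def)
  have "sum ?h ?O = sum ?h ?E"
    using perm parity invol same
    by (intro sum.reindex_bij_witness[of _ "\<lambda>p. ?t \<circ> p" "\<lambda>p. ?t \<circ> p"]) blast+
  moreover have "permanent A = sum ?h ?E + sum ?h ?O"
  proof -
    have "?P = ?E \<union> ?O" by auto
    then have "permanent A = sum ?h (?E \<union> ?O)" by (simp only: permanent_carrier[OF A])
    also have "\<dots> = sum ?h ?E + sum ?h ?O"
      using finite_permutations[of "{0..<n}"] by (intro sum.union_disjoint) auto
    finally show ?thesis .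
  qed
  ultimately have "permanent A = nu (sum ?h ?E)" by (simp add: nu_def)
  then show thesis by (rule that)
qed

text \<open>Overwriting column \<open>i\<close> leaves every minor that omits column \<open>i\<close> unchanged, so the
  product with the adjoint is the expansion of the overwritten matrix along that column.\<close>

lemma perm_adj_mult_entry:
  fixes A :: "'a::comm_semiring_1 mat"
  assumes A: "A \<in> carrier_mat n n" and i: "i < n" and j: "j < n"
  shows "(perm_adj A * A) $$ (i, j)
    = permanent (mat n n (\<lambda>(r, c). A $$ (r, if c = i then j else c)))"
proof -
  let ?C = "mat n n (\<lambda>(r, c). A $$ (r, if c = i then j else c))"
  have minor: "mat_delete ?C k i = mat_delete A k i" if "k < n" for k
    using A i that unfolding mat_delete_def by (intro eq_matI) auto
  have "(perm_adj A * A) $$ (i, j) = (\<Sum>k<n. permanent (mat_delete A k i) * A $$ (k, j))"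
    using A i j by (simp add: perm_adj_def scalar_prod_def atLeast0LessThan)
  also have "\<dots> = (\<Sum>k<n. ?C $$ (k, i) * permanent (mat_delete ?C k i))"
    using i by (intro sum.cong) (auto simp: minor mult.commute)
  also have "\<dots> = permanent ?C"
    using i by (intro permanent_expand_column[symmetric]) auto
  finally show ?thesis .
qed

lemma unit_inverse_mult:
  fixes a :: "'a::comm_semiring_1"
  assumes "a dvd 1"
  shows "unit_inverse a * a = 1"
proof -
  obtain b where b: "a * b = 1" using assms by (metis dvd_def)
  have "unit_inverse a = b" unfolding unit_inverse_def
  proof (rule the_equality)
    show "a * b = 1" by (fact b)
  next
    fix c assume "a * c = 1"
    then show "c = b" using b by (metis mult.assoc mult.commute mult_1)
  qed
  then show ?thesis using b by (simp add: mult.commute)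
qed

lemma nabla_carrier:
  assumes "A \<in> carrier_mat n n"
  shows "nabla A \<in> carrier_mat n n"
  using assms unfolding nabla_def perm_adj_def by auto

lemma nabla_mult:
  assumes "A \<in> carrier_mat n n"
  shows "nabla A * A = unit_inverse (permanent A) \<cdot>\<^sub>m (perm_adj A * A)"
  using assms unfolding nabla_def perm_adj_def
  by (intro mult_smult_assoc_mat[of _ n n _ n]) auto

lemma nabla_mult_diagonal:
  assumes A: "A \<in> carrier_mat n n" and "quasi_invertible A" and i: "i < n"
  shows "(nabla A * A) $$ (i, i) = 1"
proof -
  have "mat n n (\<lambda>(r, c). A $$ (r, if c = i then i else c)) = A"
    using A by (intro eq_matI) auto
  then have "(perm_adj A * A) $$ (i, i) = permanent A"
    using perm_adj_mult_entry[OF A i i] by simp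
  then show ?thesis
    using assms unit_inverse_mult[of "permanent A"]
    by (simp add: nabla_mult[OF A] quasi_invertible_def perm_adj_def)
qed

context semiring_with_ghosts
begin

lemma sum_ghost: "(\<And>x. x \<in> S \<Longrightarrow> f x \<in> G0) \<Longrightarrow> sum f S \<in> G0"
  by (induction S rule: infinite_finite_induct) (auto intro: zero_ghost add_ghost)

end

lemma nabla_mult_off_diagonal:
  assumes "semiring_with_ghosts G0"
    and A: "A \<in> carrier_mat n n" and i: "i < n" and j: "j < n" and ij: "i \<noteq> j"
  shows "(nabla A * A) $$ (i, j) \<in> G0"
proof -
  interpret semiring_with_ghosts G0 by fact
  let ?C = "mat n n (\<lambda>(r, c). A $$ (r, if c = i then j else c))"
  obtain x where "permanent ?C = nu x"
    using ij i j by (rule_tac permanent_equal_columns[of ?C n i j]) auto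
  then have "(perm_adj A * A) $$ (i, j) \<in> G0"
    using nu_ghost by (simp only: perm_adj_mult_entry[OF A i j])
  then show ?thesis
    using A i j by (simp add: nabla_mult[OF A] perm_adj_def mult_ghost_left)
qed

text \<open>The unit diagonal of \<open>S\<close> reproduces the entry of \<open>B\<close>; every other summand has a ghost factor,
  and the ghosts form an ideal.\<close>

lemma ghost_surpasses_mult_left:
  assumes "semiring_with_ghosts G0"
    and S: "S \<in> carrier_mat n n" and B: "B \<in> carrier_mat n m"
    and diag: "\<And>i. i < n \<Longrightarrow> S $$ (i, i) = 1"
    and off: "\<And>i j. i < n \<Longrightarrow> j < n \<Longrightarrow> i \<noteq> j \<Longrightarrow> S $$ (i, j) \<in> G0"
  shows "mat_ghost_surpasses G0 (S * B) B"
proof -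
  interpret semiring_with_ghosts G0 by fact
  have "ghost_surpasses G0 ((S * B) $$ (i, j)) (B $$ (i, j))" if i: "i < n" and j: "j < m" for i j
  proof -
    let ?g = "\<Sum>k\<in>{0..<n} - {i}. S $$ (i, k) * B $$ (k, j)"
    have "(S * B) $$ (i, j) = (\<Sum>k = 0..<n. S $$ (i, k) * B $$ (k, j))"
      using S B i j by (simp add: scalar_prod_def)
    also have "\<dots> = S $$ (i, i) * B $$ (i, j) + ?g"
      using i by (intro sum.remove) auto
    finally have "(S * B) $$ (i, j) = B $$ (i, j) + ?g"
      using i by (simp add: diag)
    moreover have "?g \<in> G0"
      using i off by (intro sum_ghost mult_ghost_right) auto
    ultimately show ?thesis unfolding ghost_surpasses_def by blast
  qed
  then show ?thesis using S B unfolding mat_ghost_surpasses_def by auto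
qed

theorem lemma2p15:
  fixes G0 :: "'a::comm_semiring_1 set" and A B :: "'a mat" and n :: nat
  assumes "supertropical_domain G0"
    and "A \<in> carrier_mat n n" and "B \<in> carrier_mat n n"
    and "quasi_invertible A"
    and "A * B = quasi_identity A"
  shows "mat_ghost_surpasses G0 (nabla_bar A) B"
proof -
  have ghosts: "semiring_with_ghosts G0"
    using assms(1) by (simp add: supertropical_domain_def supertropical_semiring_def)
  note N = nabla_carrier[OF assms(2)]
  have "nabla_bar A = nabla A * (A * B)"
    unfolding nabla_bar_def assms(5) ..
  also have "\<dots> = (nabla A * A) * B"
    using assoc_mult_mat[OF N assms(2,3)] ..
  finally have "nabla_bar A = (nabla A * A) * B" .
  moreover have "mat_ghost_surpasses G0 ((nabla A * A) * B) B"
    using N assms(2,3) nabla_mult_diagonal[OF assms(2,4)]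
      nabla_mult_off_diagonal[OF ghosts assms(2)]
    by (intro ghost_surpasses_mult_left[OF ghosts, of _ n _ n]) auto
  ultimately show ?thesis by simp
qed

end
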